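(* For every integer $n>3$ there exists a Steiner triple system which has both a minimal spreading set of size $3$ and a minimal spreading set of size $n$.
   Context: A (finite) Steiner triple system is a finite set $V$ of points together with a family $\mathcal{F}$ of $3$-element subsets (triples) of $V$ such that every pair of distinct points of $V$ is contained in exactly one triple. For $V'\subseteq V$, the set of neighbours $N(V')$ consists of all $z\in V\setminus V'$ for which there exist distinct $x,y\in V'$ with $\{x,y,z\}\in\mathcal{F}$. The closure $\mathrm{cl}(V')$ is the smallest set $W\supseteq V'$ with $N(W)=\emptyset$ (it exists and is unique). A set $V'\subseteq V$ is spreading if $\mathrm{cl}(V')=V$. A spreading set is minimal if none of its proper subsets is a spreading set. Here $n$ is not the order of the system. *)

theory Defs
  imports Main "HOL.Hull"
begin

definition steiner_triple_system :: "'a set \<Rightarrow> 'a set set \<Rightarrow> bool" where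
  "steiner_triple_system V F \<longleftrightarrow>
     finite V \<and>
     (\<forall>T\<in>F. T \<subseteq> V \<and> card T = 3) \<and>
     (\<forall>x\<in>V. \<forall>y\<in>V. x \<noteq> y \<longrightarrow> (\<exists>!T. T \<in> F \<and> {x, y} \<subseteq> T))"

definition sts_neighbours :: "'a set \<Rightarrow> 'a set set \<Rightarrow> 'a set \<Rightarrow> 'a set" where
  "sts_neighbours V F S = {z \<in> V - S. \<exists>x\<in>S. \<exists>y\<in>S. x \<noteq> y \<and> {x, y, z} \<in> F}"

(* The hull is the intersection of all subsets W of V containing S that have no
   neighbours; the lemmas below confirm that it is the smallest such set. *)
definition sts_closure :: "'a set \<Rightarrow> 'a set set \<Rightarrow> 'a set \<Rightarrow> 'a set" where
  "sts_closure V F S = (\<lambda>W. W \<subseteq> V \<and> sts_neighbours V F W = {}) hull S"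

definition spreading_set :: "'a set \<Rightarrow> 'a set set \<Rightarrow> 'a set \<Rightarrow> bool" where
  "spreading_set V F S \<longleftrightarrow> S \<subseteq> V \<and> sts_closure V F S = V"

definition minimal_spreading_set :: "'a set \<Rightarrow> 'a set set \<Rightarrow> 'a set \<Rightarrow> bool" where
  "minimal_spreading_set V F S \<longleftrightarrow>
     spreading_set V F S \<and> (\<forall>S'. S' \<subset> S \<longrightarrow> \<not> spreading_set V F S')"

lemma sts_closure_closed:
  assumes "S \<subseteq> V"
  shows "S \<subseteq> sts_closure V F S" and "sts_closure V F S \<subseteq> V"
    and "sts_neighbours V F (sts_closure V F S) = {}"
proof -
  show "S \<subseteq> sts_closure V F S"
    unfolding sts_closure_def by (rule hull_subset)
  show "sts_closure V F S \<subseteq> V"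
    unfolding sts_closure_def
    by (rule hull_minimal) (simp_all add: assms sts_neighbours_def)
  show "sts_neighbours V F (sts_closure V F S) = {}"
  proof (rule equals0I)
    fix z assume "z \<in> sts_neighbours V F (sts_closure V F S)"
    then obtain x y where xy: "x \<in> sts_closure V F S" "y \<in> sts_closure V F S" "x \<noteq> y"
        "{x, y, z} \<in> F" and z: "z \<in> V" "z \<notin> sts_closure V F S"
      unfolding sts_neighbours_def by auto
    from z(2) obtain W where W: "W \<subseteq> V" "sts_neighbours V F W = {}" "S \<subseteq> W" "z \<notin> W"
      unfolding sts_closure_def hull_def by auto
    have sub: "sts_closure V F S \<subseteq> W"
      unfolding sts_closure_def by (rule hull_minimal) (simp_all add: W)
    have "z \<in> sts_neighbours V F W"
      unfolding sts_neighbours_def using subsetD[OF sub xy(1)] subsetD[OF sub xy(2)] xy(3,4) z(1) W(4)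
      by (intro CollectI conjI bexI[of _ x] bexI[of _ y] DiffI)
    with W(2) show False by simp
  qed
qed

lemma sts_closure_least:
  assumes "S \<subseteq> W" and "W \<subseteq> V" and "sts_neighbours V F W = {}"
  shows "sts_closure V F S \<subseteq> W"
  unfolding sts_closure_def by (rule hull_minimal) (simp_all add: assms)

end

(* The Bose triple system on Z_N x {0,1,2}, N odd, has the triples {(x,0),(x,1),(x,2)} and
   {(x,i),(y,i),((x+y)/2,i+1)} with x and y distinct. Reflection in a point of level i+1 preserves
   level i, so the level-0 slice of a closed set is stable under z |-> x + y - z; as soon as it has
   three points it is a coset of a subgroup of Z_N. Hence {(0,0),(1,0),(2,0)} is spreading. For N a
   product of n distinct odd primes p, the n points (N/p,0) also spread, since their differences
   generate Z_N; without (N/p,0) they lie in the proper subsystem pZ_N x {0,1,2}. *)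

theory Submission
  imports Defs "HOL-Library.Countable" "HOL-Computational_Algebra.Primes"
begin

section \<open>Spreading sets in terms of neighbour-free supersets\<close>

text \<open>The closure is itself neighbour-free and lies inside every neighbour-free superset, so
  it fills \<open>V\<close> exactly when no smaller such superset exists.\<close>

lemma spreading_set_iff:
  "spreading_set V F S \<longleftrightarrow>
     S \<subseteq> V \<and> (\<forall>W. S \<subseteq> W \<and> W \<subseteq> V \<and> sts_neighbours V F W = {} \<longrightarrow> W = V)"
proof
  assume "spreading_set V F S"
  then have S: "S \<subseteq> V" "sts_closure V F S = V"
    by (auto simp: spreading_set_def)
  show "S \<subseteq> V \<and> (\<forall>W. S \<subseteq> W \<and> W \<subseteq> V \<and> sts_neighbours V F W = {} \<longrightarrow> W = V)"
    using S sts_closure_least[of S _ V F] by blast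
next
  assume "S \<subseteq> V \<and> (\<forall>W. S \<subseteq> W \<and> W \<subseteq> V \<and> sts_neighbours V F W = {} \<longrightarrow> W = V)"
  then show "spreading_set V F S"
    using sts_closure_closed[of S V F] by (auto simp: spreading_set_def)
qed

lemma spreading_set_mono:
  "spreading_set V F S \<Longrightarrow> S \<subseteq> T \<Longrightarrow> T \<subseteq> V \<Longrightarrow> spreading_set V F T"
  unfolding spreading_set_iff by (meson order_trans)

text \<open>Spreading is monotone, so among the proper subsets only those lacking a single point
  need a check.\<close>

lemma minimal_spreading_setI:
  assumes "spreading_set V F S" and "\<And>b. b \<in> S \<Longrightarrow> \<not> spreading_set V F (S - {b})"
  shows "minimal_spreading_set V F S"
  unfolding minimal_spreading_set_def
proof (intro conjI allI impI notI)
  fix S' assume S': "S' \<subset> S" "spreading_set V F S'"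
  then obtain b where "b \<in> S" "S' \<subseteq> S - {b}" by blast
  moreover have "S - {b} \<subseteq> V" using assms(1) by (auto simp: spreading_set_def)
  ultimately show False using spreading_set_mono[OF S'(2)] assms(2) by blast
qed (fact assms(1))

section \<open>Transport of triple systems along an injection\<close>

context
  fixes f :: "'a \<Rightarrow> 'b" and V :: "'a set" and F :: "'a set set"
  assumes inj: "inj f"
begin

lemma mem_image_triples_iff: "f ` T \<in> (`) f ` F \<longleftrightarrow> T \<in> F"
  using inj by (auto simp: inj_image_eq_iff)

text \<open>The Bose points are pairs of type \<open>int * nat\<close>, while the theorem asks for
  natural numbers; an injection carries all the notions across.\<close>

lemma steiner_triple_system_image:
  assumes "steiner_triple_system V F"
  shows "steiner_triple_system (f ` V) ((`) f ` F)"
  unfolding steiner_triple_system_def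
proof (intro conjI ballI impI)
  show "finite (f ` V)" using assms by (simp add: steiner_triple_system_def)
  fix T assume "T \<in> (`) f ` F"
  then show "T \<subseteq> f ` V" "card T = 3"
    using assms inj by (auto simp: steiner_triple_system_def card_image inj_on_subset)
next
  fix x y assume "x \<in> f ` V" "y \<in> f ` V" "x \<noteq> y"
  then obtain a b where ab: "x = f a" "y = f b" "a \<in> V" "b \<in> V" "a \<noteq> b" by blast
  then have "\<exists>!T. T \<in> F \<and> {a, b} \<subseteq> T"
    using assms by (simp add: steiner_triple_system_def)
  then obtain T where T: "T \<in> F" "{a, b} \<subseteq> T" "\<forall>T'. T' \<in> F \<and> {a, b} \<subseteq> T' \<longrightarrow> T' = T"
    by (elim ex1E) blast
  have *: "{x, y} \<subseteq> f ` T' \<longleftrightarrow> {a, b} \<subseteq> T'" for T'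
    using inj ab by (auto simp: inj_image_mem_iff)
  show "\<exists>!T. T \<in> (`) f ` F \<and> {x, y} \<subseteq> T"
  proof (intro ex1I[of _ "f ` T"] conjI)
    show "T' = f ` T" if T': "T' \<in> (`) f ` F \<and> {x, y} \<subseteq> T'" for T'
    proof -
      obtain T'' where "T' = f ` T''" "T'' \<in> F" using T' by blast
      then show ?thesis using T' T(3) *[of T''] by simp
    qed
  qed (use T(1,2) * in simp_all)
qed

lemma sts_neighbours_image:
  "sts_neighbours (f ` V) ((`) f ` F) (f ` S) = f ` sts_neighbours V F S"
proof -
  have "{f x, f y, f z} \<in> (`) f ` F \<longleftrightarrow> {x, y, z} \<in> F" for x y z
    using mem_image_triples_iff[of "{x, y, z}"] by simp
  then show ?thesis
    by (simp add: sts_neighbours_def image_set_diff[OF inj, symmetric] Compr_image_eq inj_eq[OF inj])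
qed

lemma spreading_set_image: "spreading_set (f ` V) ((`) f ` F) (f ` S) \<longleftrightarrow> spreading_set V F S"
proof -
  have nb: "sts_neighbours (f ` V) ((`) f ` F) (f ` W) = {} \<longleftrightarrow> sts_neighbours V F W = {}" for W
    by (simp add: sts_neighbours_image)
  have sub: "f ` A \<subseteq> f ` B \<longleftrightarrow> A \<subseteq> B" and eq: "f ` A = f ` B \<longleftrightarrow> A = B" for A B
    using inj by (simp_all add: inj_image_subset_iff inj_image_eq_iff)
  show ?thesis
  proof
    assume *: "spreading_set (f ` V) ((`) f ` F) (f ` S)"
    show "spreading_set V F S"
      unfolding spreading_set_iff
    proof (intro conjI allI impI)
      show "S \<subseteq> V" using * by (simp add: spreading_set_iff sub)
      show "W = V" if "S \<subseteq> W \<and> W \<subseteq> V \<and> sts_neighbours V F W = {}" for W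
        using * that unfolding spreading_set_iff by (metis nb sub eq)
    qed
  next
    assume *: "spreading_set V F S"
    show "spreading_set (f ` V) ((`) f ` F) (f ` S)"
      unfolding spreading_set_iff
    proof (intro conjI allI impI)
      show "f ` S \<subseteq> f ` V" using * by (simp add: spreading_set_iff sub)
      fix W assume W: "f ` S \<subseteq> W \<and> W \<subseteq> f ` V \<and> sts_neighbours (f ` V) ((`) f ` F) W = {}"
      then obtain U where U: "U \<subseteq> V" "W = f ` U" by (meson subset_imageE)
      then have "S \<subseteq> U" "sts_neighbours V F U = {}" using W nb sub by auto
      then show "W = f ` V" using * U unfolding spreading_set_iff by blast
    qed
  qed
qed

lemma minimal_spreading_set_image:
  assumes "minimal_spreading_set V F S"
  shows "minimal_spreading_set (f ` V) ((`) f ` F) (f ` S)"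
  unfolding minimal_spreading_set_def
proof (intro conjI allI impI)
  show "spreading_set (f ` V) ((`) f ` F) (f ` S)"
    using assms by (simp add: minimal_spreading_set_def spreading_set_image)
  fix T assume "T \<subset> f ` S"
  then obtain S' where "S' \<subset> S" "T = f ` S'"
    by (metis psubset_eq subset_imageE)
  then show "\<not> spreading_set (f ` V) ((`) f ` F) T"
    using assms by (simp add: minimal_spreading_set_def spreading_set_image)
qed

end

section \<open>Steiner triple systems as quasigroups\<close>

definition triples_of :: "'a set \<Rightarrow> ('a \<Rightarrow> 'a \<Rightarrow> 'a) \<Rightarrow> 'a set set" where
  "triples_of V t = {{p, q, t p q} | p q. p \<in> V \<and> q \<in> V \<and> p \<noteq> q}"

text \<open>The algebraic form of a Steiner triple system: \<open>t p q\<close> is the third point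
  of the triple through distinct \<open>p\<close> and \<open>q\<close>, and \<open>t p p = p\<close>
  by convention. Neighbour-free sets become subalgebras.\<close>

locale steiner_quasigroup =
  fixes V :: "'a set" and t :: "'a \<Rightarrow> 'a \<Rightarrow> 'a"
  assumes finite_carrier: "finite V"
    and closed: "p \<in> V \<Longrightarrow> q \<in> V \<Longrightarrow> t p q \<in> V"
    and idem: "p \<in> V \<Longrightarrow> t p p = p"
    and comm: "p \<in> V \<Longrightarrow> q \<in> V \<Longrightarrow> t p q = t q p"
    and cancel: "p \<in> V \<Longrightarrow> q \<in> V \<Longrightarrow> t p (t p q) = q"
begin

lemma t_neq: "p \<in> V \<Longrightarrow> q \<in> V \<Longrightarrow> p \<noteq> q \<Longrightarrow> t p q \<noteq> p \<and> t p q \<noteq> q"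
  using cancel[of p q] cancel[of q p] comm[of p q] idem[of p] idem[of q] by auto

text \<open>By commutativity and cancellation each of \<open>p\<close>, \<open>q\<close>,
  \<open>t p q\<close> is the product of the other two, so any two of them recover the
  triple.\<close>

lemma triple_eq:
  assumes "p \<in> V" "q \<in> V" "p \<noteq> q" "x \<in> {p, q, t p q}" "y \<in> {p, q, t p q}" "x \<noteq> y"
  shows "{p, q, t p q} = {x, y, t x y}"
proof -
  have "t q p = t p q" "t p (t p q) = q" "t q (t p q) = p" "t (t p q) p = q" "t (t p q) q = p"
    using cancel[of p q] cancel[of q p] comm[of p q] comm[of "t p q" p] comm[of "t p q" q]
      closed[of p q] assms(1,2) by auto
  then show ?thesis using assms(4-6) by auto
qed

lemma triple_mem_iff:
  assumes "x \<in> V" "y \<in> V" "x \<noteq> y"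
  shows "T \<in> triples_of V t \<and> {x, y} \<subseteq> T \<longleftrightarrow> T = {x, y, t x y}"
proof
  assume *: "T \<in> triples_of V t \<and> {x, y} \<subseteq> T"
  then obtain p q where "p \<in> V" "q \<in> V" "p \<noteq> q" "T = {p, q, t p q}"
    unfolding triples_of_def by blast
  with * triple_eq[of p q x y] assms(3) show "T = {x, y, t x y}" by simp
next
  assume "T = {x, y, t x y}"
  then show "T \<in> triples_of V t \<and> {x, y} \<subseteq> T" using assms by (auto simp: triples_of_def)
qed

lemma steiner_triple_system: "steiner_triple_system V (triples_of V t)"
  unfolding steiner_triple_system_def
proof (intro conjI ballI impI)
  fix T assume "T \<in> triples_of V t"
  then obtain p q where pq: "p \<in> V" "q \<in> V" "p \<noteq> q" "T = {p, q, t p q}"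
    unfolding triples_of_def by blast
  then show "T \<subseteq> V" using closed by simp
  show "card T = 3" using pq t_neq[of p q] by auto
next
  fix x y assume "x \<in> V" "y \<in> V" "x \<noteq> y"
  then show "\<exists>!T. T \<in> triples_of V t \<and> {x, y} \<subseteq> T"
    using triple_mem_iff[of x y] by simp
qed (rule finite_carrier)

text \<open>Neighbours involve distinct points only; idempotence takes care of the diagonal.\<close>

lemma neighbours_empty_iff:
  assumes "W \<subseteq> V"
  shows "sts_neighbours V (triples_of V t) W = {} \<longleftrightarrow> (\<forall>p\<in>W. \<forall>q\<in>W. t p q \<in> W)"
proof
  assume empty: "sts_neighbours V (triples_of V t) W = {}"
  show "\<forall>p\<in>W. \<forall>q\<in>W. t p q \<in> W"
  proof (intro ballI)
    fix p q assume pq: "p \<in> W" "q \<in> W"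
    show "t p q \<in> W"
    proof (cases "p = q")
      case False
      then have "{p, q, t p q} \<in> triples_of V t" "t p q \<in> V"
        using pq assms closed[of p q] triple_mem_iff[of p q "{p, q, t p q}"] by blast+
      then show ?thesis using empty pq False unfolding sts_neighbours_def by blast
    qed (use pq assms idem in auto)
  qed
next
  assume W: "\<forall>p\<in>W. \<forall>q\<in>W. t p q \<in> W"
  show "sts_neighbours V (triples_of V t) W = {}"
  proof (rule equals0I)
    fix z assume "z \<in> sts_neighbours V (triples_of V t) W"
    then obtain x y where xy: "x \<in> W" "y \<in> W" "x \<noteq> y" "{x, y, z} \<in> triples_of V t" "z \<notin> W"
      unfolding sts_neighbours_def by blast
    then have "{x, y, z} = {x, y, t x y}" using triple_mem_iff[of x y "{x, y, z}"] assms by auto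
    then have "z \<in> {x, y, t x y}" by blast
    then show False using W xy by auto
  qed
qed

lemma spreading_iff:
  "spreading_set V (triples_of V t) S \<longleftrightarrow>
     S \<subseteq> V \<and> (\<forall>W. S \<subseteq> W \<and> W \<subseteq> V \<and> (\<forall>p\<in>W. \<forall>q\<in>W. t p q \<in> W) \<longrightarrow> W = V)"
  by (simp add: spreading_set_iff neighbours_empty_iff cong: conj_cong)

text \<open>A triple is already closed, so two points never generate more than three.\<close>

lemma not_spreading_pair:
  assumes "card V > 3" "p \<in> V" "q \<in> V" "p \<noteq> q"
  shows "\<not> spreading_set V (triples_of V t) {p, q}"
proof
  let ?W = "{p, q, t p q}"
  assume "spreading_set V (triples_of V t) {p, q}"
  moreover have "?W \<subseteq> V" using assms closed by simp
  moreover have "\<forall>x\<in>?W. \<forall>y\<in>?W. t x y \<in> ?W"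
  proof (intro ballI)
    fix x y assume xy: "x \<in> ?W" "y \<in> ?W"
    show "t x y \<in> ?W"
    proof (cases "x = y")
      case True
      with xy \<open>?W \<subseteq> V\<close> idem show ?thesis by (metis subsetD)
    next
      case False
      then have "?W = {x, y, t x y}" by (rule triple_eq[OF assms(2-4) xy])
      then show ?thesis by blast
    qed
  qed
  ultimately have "?W = V" unfolding spreading_iff by blast
  moreover have "card ?W \<le> 3" by (simp add: card_insert_if)
  ultimately show False using assms(1) by simp
qed

lemma minimal_spreading_triple:
  assumes "card V > 3" "spreading_set V (triples_of V t) S" "card S = 3"
  shows "minimal_spreading_set V (triples_of V t) S"
proof (rule minimal_spreading_setI[OF assms(2)])
  fix b assume "b \<in> S"
  with assms(3) have "card (S - {b}) = 2" by simp
  then obtain p q where "S - {b} = {p, q}" "p \<noteq> q" by (meson card_2_iff)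
  moreover have "S - {b} \<subseteq> V" using assms(2) by (auto simp: spreading_set_def)
  ultimately show "\<not> spreading_set V (triples_of V t) (S - {b})"
    using not_spreading_pair[OF assms(1), of p q] by simp
qed

end

section \<open>Subgroups of the integers and residues\<close>

text \<open>A set containing 0 and closed under differences is closed under sums and integer
  multiples, so Bezout's identity absorbs the elements of \<open>S\<close> one at a time.\<close>

lemma Gcd_mem_subgroup:
  fixes H :: "int set"
  assumes "0 \<in> H" "\<And>x y. x \<in> H \<Longrightarrow> y \<in> H \<Longrightarrow> x - y \<in> H" "finite S" "S \<subseteq> H"
  shows "Gcd S \<in> H"
  using assms(3,4)
proof (induction S)
  case (insert a S)
  have neg: "- x \<in> H" if "x \<in> H" for x using assms(2)[OF assms(1) that] by simp
  have add: "x + y \<in> H" if "x \<in> H" "y \<in> H" for x y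
    using assms(2)[OF that(1) neg[OF that(2)]] by simp
  have nat_mult: "int k * x \<in> H" if "x \<in> H" for x k
    by (induction k) (use assms(1) add that in \<open>auto simp: algebra_simps\<close>)
  have mult: "k * x \<in> H" if "x \<in> H" for x k
    using nat_mult[OF that] neg[OF nat_mult[OF that]] by (cases k rule: int_cases2) simp_all
  obtain u v where "u * a + v * Gcd S = gcd a (Gcd S)" using bezout_int by blast
  moreover have "u * a + v * Gcd S \<in> H" using insert by (intro add mult) auto
  ultimately show ?case by simp
qed (use assms(1) in simp)

lemma mod_middle:
  fixes N :: int
  shows "(x + b mod N - w) mod N = (x + b - w) mod N"
  by (metis mod_diff_left_eq mod_add_right_eq)

lemma mod_outer:
  fixes N :: int
  shows "(x mod N + b - w mod N) mod N = (x + b - w) mod N"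
  using mod_add_left_eq[of x N "b - w mod N"] mod_diff_right_eq[of "x + b" w N]
  by (simp add: add_diff_eq)

section \<open>The Bose triple system\<close>

text \<open>For odd \<open>N\<close> the factor \<open>(N + 1) div 2\<close> is the inverse of 2
  modulo \<open>N\<close>, so this is (x + y)/2 in Z_N.\<close>

definition midpoint_mod :: "int \<Rightarrow> int \<Rightarrow> int \<Rightarrow> int" where
  "midpoint_mod N x y = ((N + 1) div 2 * (x + y)) mod N"

text \<open>For odd \<open>N\<close> this is the residue whose midpoint with \<open>x\<close> is
  \<open>y\<close>.\<close>

definition reflect_mod :: "int \<Rightarrow> int \<Rightarrow> int \<Rightarrow> int" where
  "reflect_mod N x y = (2 * y - x) mod N"

definition bose_points :: "int \<Rightarrow> (int \<times> nat) set" where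
  "bose_points N = {0..<N} \<times> {0, 1, 2}"

text \<open>Levels sum to 3, so \<open>3 - i - j\<close> is the level missing from a vertical
  triple. Two different levels are cyclically adjacent, hence the last branch is the one where
  \<open>i\<close> follows \<open>j\<close>.\<close>

definition bose :: "int \<Rightarrow> int \<times> nat \<Rightarrow> int \<times> nat \<Rightarrow> int \<times> nat" where
  "bose N = (\<lambda>(x, i) (y, j).
     if x = y then (x, if i = j then i else 3 - i - j)
     else if i = j then (midpoint_mod N x y, Suc i mod 3)
     else if j = Suc i mod 3 then (reflect_mod N x y, i)
     else (reflect_mod N y x, j))"

locale bose_system =
  fixes N :: int
  assumes odd: "odd N" and gt1: "N > 1"
begin

abbreviation "mid \<equiv> midpoint_mod N"
abbreviation "rfl \<equiv> reflect_mod N"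
abbreviation "V \<equiv> bose_points N"
abbreviation "F \<equiv> triples_of V (bose N)"

lemma half_double: "(N + 1) div 2 * (2 * x) = x + N * x"
proof -
  obtain k where k: "N = 2 * k + 1" using odd by (rule oddE)
  then have "(N + 1) div 2 = k + 1" by simp
  then show ?thesis by (simp add: k algebra_simps)
qed

lemma mid_range: "mid x y \<in> {0..<N}" and refl_range: "rfl x y \<in> {0..<N}"
  using gt1 by (auto simp: midpoint_mod_def reflect_mod_def)

lemma mid_commute: "mid x y = mid y x"
  by (simp add: midpoint_mod_def add.commute)

lemma mid_same: "x \<in> {0..<N} \<Longrightarrow> mid x x = x"
  using half_double[of x] unfolding midpoint_mod_def mult_2 by simp

lemma refl_same: "x \<in> {0..<N} \<Longrightarrow> rfl x x = x"
  by (simp add: reflect_mod_def)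

lemma mid_refl: "y \<in> {0..<N} \<Longrightarrow> mid x (rfl x y) = y"
proof -
  assume y: "y \<in> {0..<N}"
  have "mid x (rfl x y) = ((N + 1) div 2 * (x + (2 * y - x))) mod N"
    unfolding midpoint_mod_def reflect_mod_def by (metis mod_add_right_eq mod_mult_right_eq)
  then show ?thesis using half_double[of y] y by simp
qed

lemma double_mid: "(2 * mid x y) mod N = (x + y) mod N"
proof -
  have "(2 * mid x y) mod N = (2 * ((N + 1) div 2 * (x + y))) mod N"
    unfolding midpoint_mod_def by (simp only: mod_simps)
  also have "2 * ((N + 1) div 2 * (x + y)) = x + y + N * (x + y)"
    using half_double[of "x + y"] by (simp only: mult.left_commute)
  also have "\<dots> mod N = (x + y) mod N" by simp
  finally show ?thesis .
qed

text \<open>Doubling the midpoint undoes the halving. The affine combination that results is the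
  move available inside one level.\<close>

lemma refl_mid: "rfl z (mid x y) = (x + y - z) mod N"
  unfolding reflect_mod_def using double_mid by (metis mod_diff_left_eq)

lemma mid_neq: "x \<in> {0..<N} \<Longrightarrow> y \<in> {0..<N} \<Longrightarrow> x \<noteq> y \<Longrightarrow> mid x y \<noteq> x"
  using refl_mid[of x x y] refl_same[of x] by auto

lemma refl_neq: "x \<in> {0..<N} \<Longrightarrow> y \<in> {0..<N} \<Longrightarrow> x \<noteq> y \<Longrightarrow> rfl x y \<noteq> x \<and> rfl x y \<noteq> y"
  using mid_refl[of y x] mid_same[of x] mid_neq[of y x] mid_commute[of x y] by auto

lemma refl_refl: "x \<in> {0..<N} \<Longrightarrow> rfl (rfl x y) y = x"
proof -
  assume x: "x \<in> {0..<N}"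
  have "rfl (rfl x y) y = (2 * y - (2 * y - x)) mod N"
    unfolding reflect_mod_def by (simp only: mod_simps)
  then show ?thesis using x by simp
qed

sublocale steiner_quasigroup V "bose N"
proof
  show "finite V" by (simp add: bose_points_def)
  fix p q assume pq: "p \<in> V" "q \<in> V"
  obtain x i y j where [simp]: "p = (x, i)" "q = (y, j)" by fastforce
  have r: "x \<in> {0..<N}" "y \<in> {0..<N}" "i = 0 \<or> i = 1 \<or> i = 2" "j = 0 \<or> j = 1 \<or> j = 2"
    using pq by (auto simp: bose_points_def)
  show "bose N p q \<in> V"
    using r(3,4) by (elim disjE)
      (simp_all add: bose_def bose_points_def r(1,2)[simplified]
        mid_range[simplified] refl_range[simplified])
  show "bose N p p = p" by (simp add: bose_def)
  show "bose N p q = bose N q p"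
    using r(3,4) by (elim disjE) (simp_all add: bose_def mid_commute[of x y])
  show "bose N p (bose N p q) = q"
  proof (cases "x = y")
    case True
    then show ?thesis using r(3,4) by (elim disjE) (simp_all add: bose_def)
  next
    case False
    have "rfl x (mid x y) = y" using refl_mid[of x x y] r(2) by simp
    note facts = this False mid_refl[OF r(2), of x] refl_refl[OF r(2), of x] refl_refl[OF r(1), of y]
    \<comment> \<open>These inequalities keep the outer application of \<open>bose\<close> out of
      its first branch, so the identities in \<open>facts\<close> apply.\<close>
    have "x \<noteq> mid x y" "x \<noteq> rfl x y" "x \<noteq> rfl y x"
      using mid_neq[OF r(1,2) False] refl_neq[OF r(1,2) False] refl_neq[OF r(2,1) False[symmetric]]
      by metis+
    with facts show ?thesis using r(3,4)
      by (elim disjE) (simp_all add: bose_def)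
  qed
qed

section \<open>Closed sets and spreading in the Bose system\<close>

lemma card_points: "card V > 3"
  using gt1 by (simp add: bose_points_def card_cartesian_product)

text \<open>Reflecting \<open>z\<close> at the midpoint of \<open>x\<close> and \<open>y\<close>, which lies on the next level, stays on the
  level of \<open>z\<close>. A third point \<open>w\<close> of the level supplies the missing case \<open>x = y\<close>.\<close>

lemma level_affine:
  assumes W: "W \<subseteq> V" "\<forall>p\<in>W. \<forall>q\<in>W. bose N p q \<in> W"
    and three: "card S \<ge> 3" "\<And>s. s \<in> S \<Longrightarrow> (s, 0) \<in> W"
    and xyz: "(x, 0) \<in> W" "(y, 0) \<in> W" "(z, 0) \<in> W"
  shows "((x + y - z) mod N, 0) \<in> W"
proof -
  have distinct: "((x + y - z) mod N, 0) \<in> W"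
    if "(x, 0) \<in> W" "(y, 0) \<in> W" "(z, 0) \<in> W" "x \<noteq> y" for x y z
  proof -
    have "bose N (x, 0) (y, 0) \<in> W" using W that by blast
    then have "(mid x y, 1) \<in> W" using that by (simp add: bose_def)
    with W(2) that(3) have "bose N (z, 0) (mid x y, 1) \<in> W" by blast
    moreover have "z \<in> {0..<N}" using that W(1) by (auto simp: bose_points_def)
    \<comment> \<open>If \<open>z\<close> is itself the midpoint, \<open>bose\<close> follows the
      vertical triple to level 2; but then the reflection fixes \<open>z\<close>, which is in
      \<open>W\<close> already.\<close>
    ultimately have "(rfl z (mid x y), 0) \<in> W"
      using that refl_same[of z] by (cases "z = mid x y") (auto simp: bose_def)
    then show ?thesis by (simp add: refl_mid)
  qed
  have range: "s \<in> {0..<N}" if "(s, 0) \<in> W" for s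
    using that W(1) by (auto simp: bose_points_def)
  show ?thesis
  proof (cases "x = y")
    case True
    have "\<not> S \<subseteq> {x, z}"
    proof
      assume "S \<subseteq> {x, z}"
      then have "card S \<le> card {x, z}" by (intro card_mono) auto
      also have "\<dots> \<le> 2" by (simp add: card_insert_if)
      finally show False using three by simp
    qed
    then obtain w where w: "(w, 0) \<in> W" "w \<noteq> x" "w \<noteq> z" using three by blast
    \<comment> \<open>The target \<open>2 * x - z\<close> takes two moves with distinct arguments:
      first \<open>x + w - z\<close>, then \<open>x + (x + w - z) - w\<close>.\<close>
    have "((x + w - z) mod N, 0) \<in> W" using distinct[of x w z] w xyz by simp
    moreover have "x \<noteq> (x + w - z) mod N"
    proof
      assume "x = (x + w - z) mod N"
      then have "(x + w - z) mod N = x mod N" by (metis mod_mod_trivial)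
      then have "N dvd (x + w - z) - x" by (simp only: mod_eq_dvd_iff)
      then have "N dvd w - z" by simp
      then have "w mod N = z mod N" by (simp add: mod_eq_dvd_iff)
      then show False using range[OF w(1)] range[OF xyz(3)] w(3) by simp
    qed
    ultimately have "((x + (x + w - z) mod N - w) mod N, 0) \<in> W"
      using distinct[of x "(x + w - z) mod N" w] w xyz by simp
    moreover have "(x + (x + w - z) mod N - w) mod N = (x + (x + w - z) - w) mod N"
      by (rule mod_middle)
    ultimately show ?thesis using True by (simp add: algebra_simps)
  qed (use distinct xyz in blast)
qed

text \<open>In a closed set containing \<open>S\<close> on level 0, the displacements from
  \<open>a\<close> within that level, lifted to the integers, form a subgroup containing
  \<open>N\<close> and all \<open>s - a\<close>. Gcd 1 puts 1 into it, which yields all of level 0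
  and then the other levels.\<close>

lemma spreading_of_coprime_differences:
  assumes S: "S \<subseteq> {0..<N}" "card S \<ge> 3" "a \<in> S"
    and gcd: "Gcd (insert N ((\<lambda>s. s - a) ` S)) = 1"
  shows "spreading_set V F (S \<times> {0})"
  unfolding spreading_iff
proof (intro conjI allI impI)
  show "S \<times> {0} \<subseteq> V" using S by (auto simp: bose_points_def)
  fix W assume "S \<times> {0} \<subseteq> W \<and> W \<subseteq> V \<and> (\<forall>p\<in>W. \<forall>q\<in>W. bose N p q \<in> W)"
  then have W: "W \<subseteq> V" "\<forall>p\<in>W. \<forall>q\<in>W. bose N p q \<in> W" and SW: "\<And>s. s \<in> S \<Longrightarrow> (s, 0) \<in> W"
    by auto
  have finS: "finite S" using S(2) by (metis card.infinite not_numeral_le_zero)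
  have affine: "((x + y - z) mod N, 0) \<in> W"
    if "(x, 0) \<in> W" "(y, 0) \<in> W" "(z, 0) \<in> W" for x y z
    using level_affine[OF W S(2) SW] that by blast
  define H where "H = {h. ((a + h) mod N, 0) \<in> W}"
  have a: "(a, 0) \<in> W" "a \<in> {0..<N}" using S SW by auto
  have "1 \<in> H"
  proof -
    have "0 \<in> H" using a by (simp add: H_def)
    moreover have "x - y \<in> H" if "x \<in> H" "y \<in> H" for x y
    proof -
      \<comment> \<open>The combination \<open>(a + x) + a - (a + y)\<close> equals
        \<open>a + (x - y)\<close>.\<close>
      have "(((a + x) mod N + a - (a + y) mod N) mod N, 0) \<in> W"
        using affine that a by (simp add: H_def)
      moreover have "((a + x) mod N + a - (a + y) mod N) mod N = ((a + x) + a - (a + y)) mod N"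
        by (rule mod_outer)
      ultimately show ?thesis by (simp add: H_def algebra_simps)
    qed
    moreover have "insert N ((\<lambda>s. s - a) ` S) \<subseteq> H"
    proof -
      have "s mod N = s" if "s \<in> S" for s using that S(1) by auto
      then show ?thesis using SW a by (auto simp: H_def)
    qed
    ultimately show ?thesis
      using Gcd_mem_subgroup[of H "insert N ((\<lambda>s. s - a) ` S)"] finS gcd by simp
  qed
  have step: "((x + 1) mod N, 0) \<in> W" if "(x, 0) \<in> W" for x
  proof -
    \<comment> \<open>Combining \<open>x\<close> with the points \<open>a + 1\<close> and
      \<open>a\<close> of the level translates \<open>x\<close> by 1.\<close>
    have "((x + (a + 1) mod N - a) mod N, 0) \<in> W"
      using affine[OF that _ a(1)] \<open>1 \<in> H\<close> by (simp add: H_def)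
    moreover have "(x + (a + 1) mod N - a) mod N = (x + (a + 1) - a) mod N"
      by (rule mod_middle)
    ultimately show ?thesis by (simp add: algebra_simps)
  qed
  have "((a + int k) mod N, 0) \<in> W" for k
  proof (induction k)
    case (Suc k)
    have "((a + int k) mod N + 1) mod N = (a + int (Suc k)) mod N"
      using mod_add_left_eq[of "a + int k" N 1] by (simp add: ac_simps)
    then show ?case using step[OF Suc] by simp
  qed (use a in simp)
  then have level0: "(x, 0) \<in> W" if "x \<in> {0..<N}" for x
  proof -
    \<comment> \<open>Adding \<open>N\<close> keeps the number of unit steps from \<open>a\<close>
      to \<open>x\<close> positive, so \<open>nat\<close> does not truncate.\<close>
    have "((a + int (nat (x + N - a))) mod N, 0) \<in> W" by fact
    moreover have "(a + int (nat (x + N - a))) mod N = x" using that a(2) by simp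
    ultimately show ?thesis by simp
  qed
  have level1: "(x, 1) \<in> W" if x: "x \<in> {0..<N}" for x
  proof -
    \<comment> \<open>Any \<open>y\<close> other than \<open>x\<close> serves: \<open>y\<close> and
      its reflection in \<open>x\<close> are distinct points of level 0 with midpoint
      \<open>x\<close>.\<close>
    have "(if x = 0 then 1 else 0) \<in> {0..<N}" "(if x = 0 then 1 else 0) \<noteq> x" using gt1 by auto
    then obtain y where y: "y \<in> {0..<N}" "y \<noteq> x" by blast
    have "bose N (y, 0) (rfl y x, 0) \<in> W" using W(2) level0 y refl_range by blast
    then show ?thesis using refl_neq[OF y(1) x y(2)] mid_refl[OF x, of y]
      by (auto simp: bose_def split: if_splits)
  qed
  have level2: "(x, 2) \<in> W" if "x \<in> {0..<N}" for x
  proof -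
    have "bose N (x, 0) (x, 1) \<in> W" using W(2) level0 level1 that by blast
    then show ?thesis by (simp add: bose_def numeral_2_eq_2 eval_nat_numeral)
  qed
  show "W = V"
    using W(1) level0 level1 level2 by (auto simp: bose_points_def)
qed

text \<open>As \<open>p\<close> divides \<open>N\<close>, reduction modulo \<open>N\<close>
  preserves divisibility by \<open>p\<close>, so midpoints and reflections of multiples of
  \<open>p\<close> are again multiples.\<close>

lemma closed_multiples:
  assumes p: "p dvd N" and W: "W = {x \<in> V. p dvd fst x}"
  shows "\<forall>x\<in>W. \<forall>y\<in>W. bose N x y \<in> W"
proof (intro ballI)
  fix x y assume xy: "x \<in> W" "y \<in> W"
  have "p dvd mid a b" "p dvd rfl a b" if "p dvd a" "p dvd b" for a b
    using that p by (simp_all add: midpoint_mod_def reflect_mod_def dvd_mod)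
  then have "p dvd fst (bose N x y)"
    using xy W by (auto simp: bose_def split: prod.splits)
  moreover have "bose N x y \<in> V" using xy W closed by blast
  ultimately show "bose N x y \<in> W" using W by blast
qed

text \<open>The closed set of points over multiples of \<open>p\<close> misses \<open>(1, 0)\<close>
  when \<open>p\<close> is not a unit.\<close>

lemma not_spreading_multiples:
  assumes "p dvd N" "\<not> is_unit p" "\<And>s. s \<in> S \<Longrightarrow> p dvd fst s"
  shows "\<not> spreading_set V F S"
proof
  assume sp: "spreading_set V F S"
  let ?W = "{x \<in> V. p dvd fst x}"
  have "S \<subseteq> ?W" "?W \<subseteq> V" using sp assms(3) by (auto simp: spreading_set_def)
  then have "?W = V"
    using sp closed_multiples[OF assms(1) HOL.refl] by (simp add: spreading_iff)
  moreover have "(1, 0) \<in> V" using gt1 by (simp add: bose_points_def)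
  ultimately have "(1, 0) \<in> ?W" by simp
  then show False using assms(2) by simp
qed

end

section \<open>Products of distinct odd primes and the two minimal spreading sets\<close>

theorem theorem1p6:
  fixes n :: nat
  assumes "n > 3"
  shows "\<exists>(V :: nat set) F. steiner_triple_system V F \<and>
           (\<exists>A. minimal_spreading_set V F A \<and> card A = 3) \<and>
           (\<exists>B. minimal_spreading_set V F B \<and> card B = n)"
proof -
  \<comment> \<open>The prime 2 is left out so that the product \<open>N\<close> is odd.\<close>
  have "infinite (int ` {p. prime p} - {2})"
    using primes_infinite by (simp add: finite_image_iff)
  then obtain P :: "int set" where P: "finite P" "card P = n" "P \<subseteq> int ` {p. prime p} - {2}"
    by (meson infinite_arbitrarily_large)
  have prime: "prime p" "p > 2" if "p \<in> P" for p :: int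
  proof -
    obtain q where q: "p = int q" "prime q" "q \<noteq> 2" using subsetD[OF P(3) \<open>p \<in> P\<close>] by auto
    then show "prime p" "p > 2" using prime_ge_2_nat[of q] by auto
  qed
  define N where "N = \<Prod>P"
  define c where "c p = \<Prod>(P - {p})" for p
  have N: "N = p * c p" if "p \<in> P" for p
    using prod.remove[OF P(1) that, of "\<lambda>x. x"] by (simp add: N_def c_def)
  have cpos: "c p > 0" for p
    unfolding c_def using prime by (intro prod_pos) force
  have dvd: "p dvd c q" if "p \<in> P" "p \<noteq> q" for p q
    unfolding c_def using that P(1) by (intro dvd_prodI) auto
  have ndvd: "\<not> p dvd c p" if "p \<in> P" for p
  proof
    assume "p dvd c p"
    then obtain q where q: "q \<in> P - {p}" "p dvd q"
      using prime_dvd_prod_iff[of "P - {p}" p "\<lambda>x. x"] prime[OF \<open>p \<in> P\<close>] P(1) by (auto simp: c_def)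
    then show False using primes_dvd_imp_eq[of p q] prime that by auto
  qed
  have ge: "N > c p" if "p \<in> P" for p
    using N[OF that] cpos[of p] prime(2)[OF that] by simp
  have "inj_on c P"
    \<comment> \<open>If \<open>c p = c q\<close> with \<open>p\<close> and \<open>q\<close>
      distinct, then \<open>p\<close> divides \<open>c q\<close> but not \<open>c p\<close>.\<close>
    by (rule inj_onI) (use dvd ndvd in force)
  then have card_c: "card (c ` P) = n" using P(2) by (simp add: card_image)
  obtain p0 where p0: "p0 \<in> P" using P(2) assms by fastforce
  have "odd N"
  proof
    assume "even N"
    then obtain q where "q \<in> P" "2 dvd q"
      using prime_dvd_prod_iff[of P 2 "\<lambda>x. x"] P(1) by (auto simp: N_def)
    then show False using primes_dvd_imp_eq[of 2 q] prime by force
  qed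
  moreover have "N > 2"
    using N[OF p0] cpos[of p0] prime(2)[OF p0] mult_mono[of 3 p0 1 "c p0"] by linarith
  ultimately interpret bose_system N by unfold_locales auto
  have A: "minimal_spreading_set V F ({0, 1, 2} \<times> {0})"
  proof (rule minimal_spreading_triple[OF card_points])
    show "spreading_set V F ({0, 1, 2} \<times> {0})"
      \<comment> \<open>With base point 0 the difference 1 already forces the gcd to be 1.\<close>
      using \<open>N > 2\<close> by (intro spreading_of_coprime_differences[of _ 0]) auto
    show "card ({0, 1, 2 :: int} \<times> {0 :: nat}) = 3" by (simp add: card_cartesian_product)
  qed
  have B: "minimal_spreading_set V F (c ` P \<times> {0})"
  proof (rule minimal_spreading_setI)
    have "Gcd (insert N ((\<lambda>s. s - c p0) ` c ` P)) = 1" (is "?g = 1")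
    proof (rule ccontr)
      assume "?g \<noteq> 1"
      then have "\<not> is_unit ?g" by (metis zdvd1_eq abs_of_nonneg Gcd_int_greater_eq_0)
      moreover have "?g \<noteq> 0" using \<open>N > 2\<close> by simp
      ultimately obtain p where p: "prime p" "p dvd ?g"
        using prime_divisor_exists[of ?g] by blast
      then have pN: "p dvd N" and diff: "\<And>q. q \<in> P \<Longrightarrow> p dvd c q - c p0"
        using dvd_trans[OF p(2) Gcd_dvd] by auto
      then obtain r where "r \<in> P" "p dvd r"
        using prime_dvd_prod_iff[of P p "\<lambda>x. x"] P(1) p(1) by (auto simp: N_def)
      then have "p \<in> P" using primes_dvd_imp_eq[of p r] p(1) prime by auto
      have "P \<noteq> {p}" using P(2) assms by auto
      then obtain q where q: "q \<in> P" "q \<noteq> p" using \<open>p \<in> P\<close> by blast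
      \<comment> \<open>This sum is \<open>c p\<close>: all values of \<open>c\<close> agree modulo
        \<open>p\<close>, and \<open>c q\<close> vanishes there, so \<open>c p\<close> would vanish
        as well.\<close>
      have "p dvd (c p - c p0) - (c q - c p0) + c q"
        by (rule dvd_add[OF dvd_diff[OF diff[OF \<open>p \<in> P\<close>] diff[OF q(1)]]
              dvd[OF \<open>p \<in> P\<close> q(2)[symmetric]]])
      then show False using ndvd \<open>p \<in> P\<close> by simp
    qed
    moreover have "c ` P \<subseteq> {0..<N}" using cpos ge by (auto simp: less_imp_le)
    ultimately show "spreading_set V F (c ` P \<times> {0})"
      using p0 card_c assms by (intro spreading_of_coprime_differences[of _ "c p0"]) auto
    fix b assume "b \<in> c ` P \<times> {0 :: nat}"
    then obtain p where p: "p \<in> P" "b = (c p, 0)" by auto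
    \<comment> \<open>Without \<open>c p\<close>, every remaining first coordinate is some
      \<open>c q\<close> with \<open>q\<close> different from \<open>p\<close>, hence a multiple of
      \<open>p\<close>.\<close>
    show "\<not> spreading_set V F (c ` P \<times> {0} - {b})"
    proof (rule not_spreading_multiples)
      show "p dvd N" using N[OF p(1)] by simp
      show "\<not> is_unit p" using prime(1)[OF p(1)] not_prime_unit by blast
      fix s assume "s \<in> c ` P \<times> {0} - {b}"
      then obtain q where "s = (c q, 0)" "p \<noteq> q" using p(2) by auto
      then show "p dvd fst s" using dvd[OF p(1)] by simp
    qed
  qed
  let ?f = "to_nat :: int \<times> nat \<Rightarrow> nat"
  have inj: "inj ?f" by simp
  have card: "card (?f ` S) = card S" for S
    by (rule card_image) (rule inj_on_subset[OF inj subset_UNIV])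
  show ?thesis
  proof (rule exI[of _ "?f ` V"], rule exI[of _ "(`) ?f ` F"], intro conjI)
    show "steiner_triple_system (?f ` V) ((`) ?f ` F)"
      by (rule steiner_triple_system_image[OF inj steiner_triple_system])
    show "\<exists>A. minimal_spreading_set (?f ` V) ((`) ?f ` F) A \<and> card A = 3"
      by (rule exI, rule conjI, rule minimal_spreading_set_image[OF inj A])
        (simp add: card card_cartesian_product)
    show "\<exists>B. minimal_spreading_set (?f ` V) ((`) ?f ` F) B \<and> card B = n"
      by (rule exI, rule conjI, rule minimal_spreading_set_image[OF inj B])
        (simp add: card card_cartesian_product card_c)
  qed
qed

end
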